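(* Let $\sigma$ be a permutation of length $k\ge 2$. If $\sigma(1)$ and $\sigma(2)$ are consecutive integers, then for every $n\ge k$ there exists a permutation $\pi$ of length $n$ such that $|s_{\{\sigma\}}^{-1}(\pi)|=C_{n-k+2}$. If $\sigma(1)$ and $\sigma(2)$ are not consecutive integers, then for every $n>k$ there is no permutation $\pi$ of length $n$ with $|s_{\{\sigma\}}^{-1}(\pi)|=C_{n-k+2}$. Here $C_m=\frac{1}{m+1}\binom{2m}{m}$ is the $m$th Catalan number and the preimage is taken in the set of permutations of length $n$.
   Context: A sequence of distinct integers contains a permutation $\tau$ if some subsequence is order-isomorphic to $\tau$; otherwise it avoids $\tau$. For a set $T$ of permutations (each of length at least 2), the map $s_T$ is defined by: read the input permutation left to right with an initially empty stack and output; at each step, if there is a next input element and pushing it keeps the stack contents, read from top to bottom, $T$-avoiding, push it; otherwise pop the top of the stack and append it to the output; stop when input and stack are empty; the output is $s_T(\pi)$. *)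

theory Defs
  imports "HOL-Library.Sublist" "HOL-Combinatorics.Multiset_Permutations"
begin

text \<open>
  Permutations of length \<open>n\<close> are written in one-line notation, as the lists in
  \<^term>\<open>permutations_of_set {1..n}\<close>; thus \<open>\<sigma>(i)\<close> is \<^term>\<open>\<sigma> ! (i - 1)\<close>.
\<close>

definition order_isomorphic :: "nat list \<Rightarrow> nat list \<Rightarrow> bool" where
  "order_isomorphic xs ys \<longleftrightarrow> length xs = length ys \<and>
     (\<forall>i < length xs. \<forall>j < length xs. xs ! i < xs ! j \<longleftrightarrow> ys ! i < ys ! j)"

definition contains_pattern :: "nat list \<Rightarrow> nat list \<Rightarrow> bool" where
  "contains_pattern xs \<tau> \<longleftrightarrow> (\<exists>ys. subseq ys xs \<and> order_isomorphic ys \<tau>)"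

definition avoids :: "nat list set \<Rightarrow> nat list \<Rightarrow> bool" where
  "avoids T xs \<longleftrightarrow> (\<forall>\<tau>\<in>T. \<not> contains_pattern xs \<tau>)"

text \<open>
  The first list is the stack, read from top to bottom; the second is the remaining input.
  The machine is blocked (empty stack, push forbidden) only if \<open>T\<close> contains a pattern of
  length at most 1; the value \<^term>\<open>[]\<close> returned in that case is immaterial.
\<close>

function stack_run :: "nat list set \<Rightarrow> nat list \<Rightarrow> nat list \<Rightarrow> nat list" where
  "stack_run T [] [] = []"
| "stack_run T (s # st) [] = s # stack_run T st []"
| "stack_run T [] (x # xs) = (if avoids T [x] then stack_run T [x] xs else [])"
| "stack_run T (s # st) (x # xs) =
     (if avoids T (x # s # st) then stack_run T (x # s # st) xs
      else s # stack_run T st (x # xs))"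
  by pat_completeness auto
termination
  by (relation "measure (\<lambda>(T, st, xs). length st + 2 * length xs)") auto

definition stack_map :: "nat list set \<Rightarrow> nat list \<Rightarrow> nat list" where
  "stack_map T \<pi> = stack_run T [] \<pi>"

definition catalan :: "nat \<Rightarrow> nat" where
  "catalan m = (2 * m choose m) div (m + 1)"

text \<open>The division in \<^const>\<open>catalan\<close> is exact.\<close>

lemma Suc_dvd_central_binomial: "m + 1 dvd (2 * m choose m)"
proof -
  have "(m + 1) * (2 * m choose (m + 1)) = m * (2 * m choose m)"
    using binomial_absorb_comp[of "2 * m" m] binomial_absorption[of m "2 * m"]
    by auto
  hence "m + 1 dvd m * (2 * m choose m)"
    by (metis dvd_triv_left)
  moreover have "coprime (m + 1) m"
    by simp
  ultimately show ?thesis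
    by (simp add: coprime_dvd_mult_right_iff)
qed

end

theory Submission
  imports Defs
begin

text \<open>
  A run of the \<open>\<sigma>\<close>-machine is recorded by its word of pushes and pops, and the word together
  with the output determines the input. A stack with fewer than \<open>k\<close> entries avoids \<open>\<sigma>\<close>, so the
  first \<open>k - 2\<close> entries of the input stay at the bottom of the stack until the end. They form,
  reversed, the last \<open>k - 2\<close> entries \<open>r\<close> of the output, and the rest of the run is a Dyck word
  of semilength \<open>m = n - k + 2\<close>. Hence \<open>\<pi>\<close> has at most \<open>C\<^sub>m\<close> preimages, with equality iff
  every Dyck word occurs.

  If \<open>\<sigma>(1)\<close> and \<open>\<sigma>(2)\<close> are consecutive, choose \<open>r\<close> order-isomorphic to \<open>\<sigma>(3) \<dots> \<sigma>(k)\<close> and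
  put before it \<open>m\<close> entries, monotone, whose values fill the gap left by \<open>\<sigma>(1)\<close> and \<open>\<sigma>(2)\<close>.
  Above \<open>r\<close> the machine then acts like the classical stack sorting machine, and every Dyck
  word occurs. Conversely, if \<open>m \<ge> 3\<close> and the word \<open>push pop push pop \<dots>\<close> occurs for
  \<open>\<pi> = p\<^sub>1 p\<^sub>2 p\<^sub>3 \<dots> r\<close>, then \<open>p\<^sub>2 p\<^sub>1 r\<close> and \<open>p\<^sub>3 p\<^sub>2 r\<close> are both order-isomorphic to \<open>\<sigma>\<close>. Thus
  \<open>p\<^sub>2\<close> lies relative to \<open>r\<close> both where \<open>\<sigma>(1)\<close> and where \<open>\<sigma>(2)\<close> lies relative to
  \<open>\<sigma>(3) \<dots> \<sigma>(k)\<close>, so no value separates \<open>\<sigma>(1)\<close> from \<open>\<sigma>(2)\<close>.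
\<close>

section \<open>Ballot words\<close>

text \<open>The parameter \<open>h\<close> is the current height, so that suffixes of Dyck words are
  covered; \<open>h = 0\<close> gives the Dyck words.\<close>

fun ballot_word :: "nat \<Rightarrow> bool list \<Rightarrow> bool" where
  "ballot_word h [] \<longleftrightarrow> h = 0"
| "ballot_word h (True # w) \<longleftrightarrow> ballot_word (Suc h) w"
| "ballot_word h (False # w) \<longleftrightarrow> h > 0 \<and> ballot_word (h - 1) w"

definition ballot_words :: "nat \<Rightarrow> nat \<Rightarrow> bool list set" where
  "ballot_words h l = {w. ballot_word h w \<and> length w = l}"

lemma finite_ballot_words [simp]: "finite (ballot_words h l)"
  by (rule finite_subset[OF _ finite_lists_length_eq[of UNIV l]]) (auto simp: ballot_words_def)

lemma ballot_word_length_ge: "ballot_word h w \<Longrightarrow> h \<le> length w"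
  by (induction h w rule: ballot_word.induct) auto

lemma ballot_words_Suc:
  "ballot_words h (Suc l) = (#) True ` ballot_words (Suc h) l \<union>
     (if h = 0 then {} else (#) False ` ballot_words (h - 1) l)"
proof -
  have "w \<in> ballot_words h (Suc l) \<longleftrightarrow> w \<in> (#) True ` ballot_words (Suc h) l \<union>
     (if h = 0 then {} else (#) False ` ballot_words (h - 1) l)" for w
  proof (cases w)
    case (Cons b v)
    then show ?thesis by (cases b) (auto simp: ballot_words_def)
  qed (auto simp: ballot_words_def)
  then show ?thesis by blast
qed

lemma card_ballot_words_Suc:
  "card (ballot_words h (Suc l)) = card (ballot_words (Suc h) l) +
     (if h = 0 then 0 else card (ballot_words (h - 1) l))"
  unfolding ballot_words_Suc by (subst card_Un_disjoint) (auto simp: card_image)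

lemma ballot_words_short: "l < h \<Longrightarrow> ballot_words h l = {}"
  using ballot_word_length_ge by (fastforce simp: ballot_words_def)

text \<open>The ballot formula for \<open>j\<close> pushes and \<open>h + j\<close> pops, written
  additively to avoid truncated subtraction. Removing the first letter and Pascal's rule give the
  induction on the length.\<close>

lemma card_ballot_words:
  "card (ballot_words h (h + 2 * j)) + (if j = 0 then 0 else (h + 2 * j) choose (j - 1))
     = (h + 2 * j) choose j"
proof (induction "h + 2 * j" arbitrary: h j)
  case 0
  then have "ballot_words h (h + 2 * j) = {[]}"
    by (auto simp: ballot_words_def)
  with 0 show ?case by simp
next
  case (Suc l)
  have up: "card (ballot_words (Suc h) l) + (if j < 2 then 0 else l choose (j - 2))
      = (if j = 0 then 0 else l choose (j - 1))"
  proof (cases j)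
    case 0
    then show ?thesis using Suc.hyps(2) by (simp add: ballot_words_short)
  next
    case (Suc i)
    with Suc.hyps(2) have "l = Suc h + 2 * i" by simp
    from Suc.hyps(1)[OF this] this Suc show ?thesis by (auto split: if_splits)
  qed
  have pascal: "Suc l choose i = (if i = 0 then 1 else (l choose i) + (l choose (i - 1)))" for i
    by (cases i) auto
  show ?case
  proof (cases h)
    case 0
    then obtain i where i: "j = Suc i" using Suc.hyps(2) by (cases j) auto
    \<comment> \<open>At height 0 there is no pop branch; instead the two middle binomials of the
      odd row \<open>l\<close> agree.\<close>
    have "l choose j = l choose (j - 1)"
      using Suc.hyps(2) 0 i binomial_symmetric[of j l] by simp
    with up show ?thesis unfolding Suc.hyps(2)[symmetric] card_ballot_words_Suc pascal
      using 0 i by (auto simp: numeral_2_eq_2 split: if_splits)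
  next
    case h: (Suc g)
    then have l: "l = g + 2 * j" using Suc.hyps(2) by simp
    have "card (ballot_words g l) + (if j = 0 then 0 else l choose (j - 1)) = l choose j"
      using Suc.hyps(1)[OF l] unfolding l[symmetric] .
    with up h show ?thesis unfolding Suc.hyps(2)[symmetric] card_ballot_words_Suc pascal
      by (auto simp: numeral_2_eq_2 split: if_splits)
  qed
qed

lemma catalan_eq_binomial_diff:
  "catalan m + (if m = 0 then 0 else 2 * m choose (m - 1)) = 2 * m choose m"
proof (cases m)
  case (Suc i)
  let ?c = "2 * m choose m" and ?d = "2 * m choose (m - 1)"
  have "m * ?c = (m + 1) * ?d"
    using binomial_absorb_comp[of "2 * m" i] binomial_absorption[of i "2 * m"] Suc
    by (simp add: algebra_simps)
  moreover have "(m + 1) * catalan m = ?c"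
    unfolding catalan_def by (rule dvd_mult_div_cancel[OF Suc_dvd_central_binomial])
  ultimately have "(m + 1) * (catalan m + ?d) = (m + 1) * ?c"
    by (simp add: algebra_simps)
  then show ?thesis using Suc by (metis Suc_eq_plus1 mult_cancel1 nat.distinct(1))
qed (simp add: catalan_def)

lemma card_dyck_words: "card (ballot_words 0 (2 * m)) = catalan m"
  using card_ballot_words[of 0 m] catalan_eq_binomial_diff[of m] by (simp split: if_splits)

section \<open>Stack runs as words\<close>

lemma set_mono_subseq: "subseq xs ys \<Longrightarrow> set xs \<subseteq> set ys"
  by (induction rule: list_emb.induct) auto

text \<open>
  In \<open>executes st inp w out\<close>, the letters \<^const>\<open>True\<close> and \<^const>\<open>False\<close> of \<open>w\<close> stand for
  pushes and pops, performed without any restriction on the stack contents.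
\<close>

inductive executes :: "'a list \<Rightarrow> 'a list \<Rightarrow> bool list \<Rightarrow> 'a list \<Rightarrow> bool" where
  halt: "executes [] [] [] []"
| push: "executes (x # st) inp w out \<Longrightarrow> executes st (x # inp) (True # w) out"
| pop: "executes st inp w out \<Longrightarrow> executes (s # st) inp (False # w) (s # out)"

inductive_cases executes_pushE: "executes st inp (True # w) out"
inductive_cases executes_popE: "executes st inp (False # w) out"
inductive_cases executes_NilE: "executes st inp [] out"

lemma executes_mset: "executes st inp w out \<Longrightarrow> mset out = mset st + mset inp"
  by (induction rule: executes.induct) auto

lemma executes_subseq: "executes st inp w out \<Longrightarrow> subseq st out"
  by (induction rule: executes.induct) (auto dest: subseq_Cons')

lemma executes_ballot_word: "executes st inp w out \<Longrightarrow> ballot_word (length st) w"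
  by (induction rule: executes.induct) auto

lemma executes_length: "executes st inp w out \<Longrightarrow> length w = length st + 2 * length inp"
  by (induction rule: executes.induct) auto

text \<open>Run backwards from the empty final state, a pop returns the last output entry to the
  stack and a push returns the stack top to the input.\<close>

lemma executes_input_unique:
  "executes st inp w out \<Longrightarrow> executes st' inp' w out \<Longrightarrow> st = st' \<and> inp = inp'"
  by (induction arbitrary: st' inp' rule: executes.induct)
    (blast elim: executes_NilE executes_pushE executes_popE)+

text \<open>The length condition says that \<open>w\<close> has exactly one pop per entry of
  \<open>out\<close>.\<close>

lemma executes_exists:
  assumes "ballot_word h w" "length w + h = 2 * length out"
  shows "\<exists>st inp. executes st inp w out \<and> length st = h"
  using assms
proof (induction h w arbitrary: out rule: ballot_word.induct)
  case (1 h)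
  then show ?case by (auto intro: executes.halt)
next
  case (2 h w)
  then obtain st inp where "executes st inp w out" "length st = Suc h"
    by fastforce
  moreover from this(2) obtain x st' where "st = x # st'" by (cases st) auto
  ultimately show ?case
    by (intro exI[of _ st'] exI[of _ "x # inp"]) (simp add: executes.push)
next
  case (3 h w)
  then obtain s out' where out: "out = s # out'" by (cases out) auto
  with 3 obtain st inp where "executes st inp w out'" "length st = h - 1"
    by fastforce
  then show ?case using 3 out by (intro exI[of _ "s # st"] exI[of _ inp]) (auto intro: executes.pop)
qed

text \<open>If one run pops \<open>s\<close> where the other one pushes \<open>x\<close> onto it, then the latter outputs \<open>x\<close> before \<open>s\<close>.\<close>

lemma executes_word_unique:
  assumes "executes st inp w out" "executes st inp w' out" "distinct out"
  shows "w = w'"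
proof -
  have clash: False
    if "executes (x # s # st) inp w (s # out)" "distinct (s # out)" for x s :: 'a and st inp w out
  proof -
    have "subseq (x # s # st) (s # out)"
      using executes_subseq[OF that(1)] .
    moreover have "x \<noteq> s"
      using executes_mset[OF that(1)] mset_eq_imp_distinct_iff[of "s # out" "x # s # st @ inp"] that(2)
      by auto
    ultimately have "subseq (x # s # st) out" by (simp add: subseq_Cons2_iff)
    then have "s \<in> set out" by (meson list.set_intros subseq_Cons' set_mono_subseq subsetD)
    with that show False by simp
  qed
  show ?thesis using assms
  proof (induction arbitrary: w' rule: executes.induct)
    case halt
    then show ?case by (auto elim: executes.cases)
  next
    case (push x st inp w out)
    from push.prems(1) show ?case
    proof cases
      case push
      then show ?thesis using push.IH push.prems by auto
    next
      case (pop st' w out s)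
      then show ?thesis using clash push by blast
    qed
  next
    case (pop st inp w out s)
    from pop.prems(1) show ?case
    proof cases
      case push
      then show ?thesis using clash pop by blast
    next
      case pop
      then show ?thesis using pop.IH pop.prems by auto
    qed
  qed
qed

section \<open>Runs of the pattern-avoiding machine\<close>

lemma sorted_wrt_subseq: "subseq xs ys \<Longrightarrow> sorted_wrt R ys \<Longrightarrow> sorted_wrt R xs"
  by (induction rule: list_emb.induct) (auto dest: set_mono_subseq)

lemma contains_pattern_length: "contains_pattern xs \<tau> \<Longrightarrow> length \<tau> \<le> length xs"
  by (auto simp: contains_pattern_def order_isomorphic_def dest: list_emb_length)

lemma contains_pattern_same_length:
  assumes "contains_pattern xs \<tau>" "length xs = length \<tau>"
  shows "order_isomorphic xs \<tau>"
proof -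
  obtain ys where "subseq ys xs" "order_isomorphic ys \<tau>"
    using assms(1) by (auto simp: contains_pattern_def)
  moreover from this have "ys = xs"
    using assms(2) by (intro subseq_same_length) (auto simp: order_isomorphic_def)
  ultimately show ?thesis by simp
qed

lemma contains_pattern_subseq:
  "contains_pattern xs \<tau> \<Longrightarrow> subseq xs ys \<Longrightarrow> contains_pattern ys \<tau>"
  unfolding contains_pattern_def by (meson subseq_order.order_trans)

lemma avoids_singleton: "avoids {\<sigma>} xs \<longleftrightarrow> \<not> contains_pattern xs \<sigma>"
  by (simp add: avoids_def)

lemma stack_run_empty_input: "stack_run T st [] = st"
  by (induction st) auto

lemma stack_run_push: "avoids T (x # st) \<Longrightarrow> stack_run T st (x # xs) = stack_run T (x # st) xs"
  by (cases st) auto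

lemma stack_run_push_all:
  "length xs + length st < length \<sigma> \<Longrightarrow> stack_run {\<sigma>} st (xs @ ys) = stack_run {\<sigma>} (rev xs @ st) ys"
proof (induction xs arbitrary: st)
  case (Cons x xs)
  have "avoids {\<sigma>} (x # st)"
    using contains_pattern_length[of "x # st" \<sigma>] Cons.prems by (auto simp: avoids_singleton)
  then show ?case using Cons by (simp add: stack_run_push)
qed simp

text \<open>A push is refused only if it would give at least \<open>length \<sigma>\<close> entries,
  so there is an entry above \<open>r\<close> to pop: \<open>r\<close> stays put until the input is
  used up.\<close>

lemma stack_run_executes:
  assumes "length r + 2 = length \<sigma>"
  shows "\<exists>w p. stack_run {\<sigma>} (st @ r) inp = p @ r \<and> executes st inp w p"
proof (induction "length st + 2 * length inp" arbitrary: st inp rule: less_induct)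
  case less
  show ?case
  proof (cases inp)
    case Nil
    show ?thesis
    proof (cases st)
      case Nil
      then show ?thesis using \<open>inp = []\<close> executes.halt by (auto simp: stack_run_empty_input)
    next
      case (Cons s st')
      with less[of st' inp] obtain w p where "stack_run {\<sigma>} (st' @ r) inp = p @ r" "executes st' inp w p"
        by auto
      then show ?thesis using Cons Nil by (auto intro!: exI[of _ "s # p"] executes.pop)
    qed
  next
    case (Cons x xs)
    show ?thesis
    proof (cases "avoids {\<sigma>} (x # st @ r)")
      case True
      from less[of "x # st" xs] Cons obtain w p
        where "stack_run {\<sigma>} (x # st @ r) xs = p @ r" "executes (x # st) xs w p"
        by auto
      then show ?thesis using Cons True by (auto simp: stack_run_push intro: executes.push)
    next
      case False
      then have "length \<sigma> \<le> length (x # st @ r)"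
        by (auto simp: avoids_singleton dest: contains_pattern_length)
      with assms obtain s st' where st: "st = s # st'" by (cases st) auto
      with less[of st' inp] obtain w p where "stack_run {\<sigma>} (st' @ r) inp = p @ r" "executes st' inp w p"
        by auto
      then show ?thesis using Cons False st by (auto intro!: exI[of _ "s # p"] executes.pop)
    qed
  qed
qed

text \<open>The second assumption permits every push, as the new stack above \<open>r\<close> is a
  subsequence of \<open>p\<close>. The third forces every pop while input remains, as the next input
  entry \<open>x\<close> follows the popped \<open>s\<close> in \<open>p\<close>.\<close>

lemma stack_run_eq_executes:
  assumes "executes st inp w p"
    and "\<And>a. subseq a p \<Longrightarrow> \<not> contains_pattern (a @ r) \<sigma>"
    and "sorted_wrt (\<lambda>s x. contains_pattern (x # s # r) \<sigma>) p"
  shows "stack_run {\<sigma>} (st @ r) inp = p @ r"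
  using assms
proof (induction rule: executes.induct)
  case halt
  then show ?case by (simp add: stack_run_empty_input)
next
  case (push x st inp w p)
  have "\<not> contains_pattern (x # st @ r) \<sigma>"
    using push.prems(1)[OF executes_subseq[OF push.hyps]] by simp
  then have "stack_run {\<sigma>} (st @ r) (x # inp) = stack_run {\<sigma>} (x # st @ r) inp"
    by (intro stack_run_push) (simp add: avoids_singleton)
  with push show ?case by simp
next
  case (pop st inp w p s)
  have IH: "stack_run {\<sigma>} (st @ r) inp = p @ r"
    using pop.IH pop.prems by (simp add: list_emb_Cons)
  show ?case
  proof (cases inp)
    case Nil
    then show ?thesis using IH by simp
  next
    case (Cons x xs)
    then have "x \<in> set p" using mset_eq_setD[of p "st @ inp"] executes_mset[OF pop.hyps] by simp
    then have "contains_pattern (x # s # r) \<sigma>" using pop.prems by simp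
    then have "contains_pattern (x # s # st @ r) \<sigma>"
      by (rule contains_pattern_subseq) (simp add: list_emb_append2)
    then show ?thesis using IH Cons by (simp add: avoids_singleton)
  qed
qed

section \<open>Preimages and Dyck words\<close>

definition unsort :: "'a list \<Rightarrow> bool list \<Rightarrow> 'a list" where
  "unsort p w = (THE inp. executes [] inp w p)"

lemma executes_unsort:
  assumes "w \<in> ballot_words 0 (2 * length p)"
  shows "executes [] (unsort p w) w p"
proof -
  have "\<exists>inp. executes [] inp w p"
    using executes_exists[of 0 w p] assms by (auto simp: ballot_words_def)
  then show ?thesis unfolding unsort_def
    by (metis executes_input_unique theI')
qed

lemma unsort_eq: "executes [] inp w p \<Longrightarrow> unsort p w = inp"
  unfolding unsort_def by (blast dest: executes_input_unique)

lemma inj_on_unsort: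
  assumes "distinct p"
  shows "inj_on (unsort p) (ballot_words 0 (2 * length p))"
  by (metis assms executes_unsort executes_word_unique inj_onI)

definition preimages :: "nat list \<Rightarrow> nat \<Rightarrow> nat list \<Rightarrow> nat list set" where
  "preimages \<sigma> n \<pi> = {\<rho> \<in> permutations_of_set {1..n}. stack_map {\<sigma>} \<rho> = \<pi>}"

lemma stack_map_bottom:
  assumes "length r + 2 = length \<sigma>"
  shows "stack_map {\<sigma>} (rev r @ inp) = stack_run {\<sigma>} r inp"
  using assms stack_run_push_all[of "rev r" "[]" \<sigma> inp] by (simp add: stack_map_def)

lemma preimages_subset:
  assumes r: "length r + 2 = length \<sigma>" and n: "n + 2 = length p + length \<sigma>" 
  shows "preimages \<sigma> n (p @ r) \<subseteq> (\<lambda>w. rev r @ unsort p w) ` ballot_words 0 (2 * length p)"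
proof
  fix \<rho> assume "\<rho> \<in> preimages \<sigma> n (p @ r)"
  then have \<rho>: "length \<rho> = n" "stack_map {\<sigma>} \<rho> = p @ r"
    using length_finite_permutations_of_set by (fastforce simp: preimages_def)+
  \<comment> \<open>After \<open>length r\<close> pushes the stack is \<open>r'\<close>; it
    reappears at the end of the output, which identifies it with \<open>r\<close>.\<close>
  define r' inp where "r' = rev (take (length r) \<rho>)" and "inp = drop (length r) \<rho>"
  have \<rho>_eq: "\<rho> = rev r' @ inp" and r': "length r' + 2 = length \<sigma>"
    using r n \<rho> by (auto simp: r'_def inp_def)
  obtain w p' where "stack_run {\<sigma>} r' inp = p' @ r'" and ex: "executes [] inp w p'"
    using stack_run_executes[OF r', of "[]" inp] by auto
  then have "p' @ r' = p @ r"
    using \<rho>(2) r' by (simp add: \<rho>_eq stack_map_bottom)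
  then have eq: "p' = p" "r' = r" using r r' by auto
  have "length inp = length p"
    using executes_mset[OF ex] eq by (metis mset.simps(1) add_0 size_mset)
  then have "w \<in> ballot_words 0 (2 * length p)"
    using executes_ballot_word[OF ex] executes_length[OF ex] by (simp add: ballot_words_def)
  then show "\<rho> \<in> (\<lambda>w. rev r @ unsort p w) ` ballot_words 0 (2 * length p)"
    using unsort_eq[OF ex] eq \<rho>_eq by auto
qed

text \<open>The conditions \<open>avoid\<close> and \<open>pair\<close> make the machine follow
  every Dyck word, so the bound from \<open>preimages_subset\<close> is attained.\<close>

lemma card_preimages_eq_catalan:
  assumes r: "length r + 2 = length \<sigma>" and n: "n + 2 = length p + length \<sigma>"
    and \<pi>: "p @ r \<in> permutations_of_set {1..n}"
    and avoid: "\<And>a. subseq a p \<Longrightarrow> \<not> contains_pattern (a @ r) \<sigma>"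
    and pair: "sorted_wrt (\<lambda>s x. contains_pattern (x # s # r) \<sigma>) p"
  shows "card (preimages \<sigma> n (p @ r)) = catalan (length p)"
proof -
  let ?W = "ballot_words 0 (2 * length p)"
  have "rev r @ unsort p w \<in> preimages \<sigma> n (p @ r)" if "w \<in> ?W" for w
  proof -
    note ex = executes_unsort[OF that]
    have "mset (rev r @ unsort p w) = mset (p @ r)"
      using executes_mset[OF ex] by simp
    then have "rev r @ unsort p w \<in> permutations_of_set {1..n}"
      using \<pi> unfolding permutations_of_set_def
      by (metis (mono_tags, lifting) mem_Collect_eq mset_eq_imp_distinct_iff mset_eq_setD)
    moreover have "stack_run {\<sigma>} r (unsort p w) = p @ r"
      using stack_run_eq_executes[OF ex avoid pair] by simp
    ultimately show ?thesis by (simp add: preimages_def stack_map_bottom[OF r])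
  qed
  then have "preimages \<sigma> n (p @ r) = (\<lambda>w. rev r @ unsort p w) ` ?W"
    using preimages_subset[OF r n] by blast
  moreover have "inj_on (\<lambda>w. rev r @ unsort p w) ?W"
    using inj_on_unsort[of p] permutations_of_setD(2)[OF \<pi>] by (auto simp: inj_on_def)
  ultimately show ?thesis by (simp add: card_image card_dyck_words)
qed

lemma alternating_word:
  "executes [] p (concat (replicate (length p) [True, False])) p"
  by (induction p) (auto intro: executes.intros)

lemma identity_preimage_if_catalan:
  assumes r: "length r + 2 = length \<sigma>" and n: "n + 2 = length p + length \<sigma>"
    and card: "card (preimages \<sigma> n (p @ r)) = catalan (length p)"
  shows "stack_run {\<sigma>} r p = p @ r"
proof -
  let ?W = "ballot_words 0 (2 * length p)" and ?f = "\<lambda>w. rev r @ unsort p w"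
  \<comment> \<open>The image contains all preimages but has at most as many elements, so the two
    sets coincide.\<close>
  have "card (?f ` ?W) \<le> card (preimages \<sigma> n (p @ r))"
    using card_image_le[of ?W ?f] card by (simp add: card_dyck_words)
  then have eq: "preimages \<sigma> n (p @ r) = ?f ` ?W"
    using preimages_subset[OF r n] by (simp add: card_seteq)
  note ex = alternating_word[of p]
  have "concat (replicate (length p) [True, False]) \<in> ?W"
    using executes_ballot_word[OF ex] executes_length[OF ex] by (simp add: ballot_words_def)
  then have "rev r @ p \<in> preimages \<sigma> n (p @ r)"
    unfolding eq by (rule rev_image_eqI) (simp add: unsort_eq[OF ex])
  then show ?thesis by (simp add: preimages_def stack_map_bottom[OF r])
qed

section \<open>Nonconsecutive leading entries\<close>

text \<open>Pushed onto \<open>x\<close>, the entry \<open>y\<close> would leave before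
  \<open>x\<close>. So the push is refused, and the offending stack has just
  \<open>length \<sigma>\<close> entries, hence is itself the occurrence of \<sigma>.\<close>

lemma stack_run_pops_first:
  assumes r: "length r + 2 = length \<sigma>"
    and run: "stack_run {\<sigma>} r (x # y # xs) = x # zs" and "distinct (x # zs)" "x \<noteq> y"
  shows "order_isomorphic (y # x # r) \<sigma> \<and> stack_run {\<sigma>} r (y # xs) = zs"
proof -
  have "avoids {\<sigma>} (x # r)"
    using r contains_pattern_length[of "x # r" \<sigma>] by (auto simp: avoids_singleton)
  then have run': "stack_run {\<sigma>} (x # r) (y # xs) = x # zs"
    using run by (simp add: stack_run_push)
  have "\<not> avoids {\<sigma>} (y # x # r)"
  proof
    assume "avoids {\<sigma>} (y # x # r)"
    then have "stack_run {\<sigma>} (y # x # r) xs = x # zs" using run' by simp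
    moreover obtain w p where "stack_run {\<sigma>} ([y, x] @ r) xs = p @ r" "executes [y, x] xs w p"
      using stack_run_executes[OF r] by blast
    ultimately have "subseq [y, x] (x # zs)"
      using executes_subseq by (metis append_Cons append_Nil list_emb_append2 subseq_append' subseq_rev_drop_many)
    then have "subseq [y, x] zs" using \<open>x \<noteq> y\<close> by (simp add: subseq_Cons2_iff)
    then show False using \<open>distinct (x # zs)\<close> set_mono_subseq by fastforce
  qed
  then show ?thesis
    using run' r contains_pattern_same_length[of "y # x # r" \<sigma>] by (simp add: avoids_singleton)
qed

text \<open>Both sides say \<open>y < r ! (i - 2)\<close>, since \<open>y\<close> plays
  \<open>\<sigma> ! 0\<close> in the first assumption and \<open>\<sigma> ! 1\<close> in the
  second.\<close>

lemma no_entry_between: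
  assumes "order_isomorphic (y # x # r) \<sigma>" "order_isomorphic (z # y # r) \<sigma>"
    and "2 \<le> i" "i < length \<sigma>"
  shows "\<sigma> ! 0 < \<sigma> ! i \<longleftrightarrow> \<sigma> ! 1 < \<sigma> ! i"
proof -
  have len: "length r + 2 = length \<sigma>" using assms(1) by (simp add: order_isomorphic_def)
  have nth: "(u # v # r) ! i = r ! (i - 2)" for u v
    using \<open>2 \<le> i\<close> by (simp add: nth_Cons' numeral_2_eq_2)
  have "y < r ! (i - 2) \<longleftrightarrow> \<sigma> ! 0 < \<sigma> ! i"
    using assms(1,4) len nth[of y x] unfolding order_isomorphic_def
    by (metis add_2_eq_Suc' length_Cons nth_Cons_0 zero_less_Suc)
  moreover have "y < r ! (i - 2) \<longleftrightarrow> \<sigma> ! 1 < \<sigma> ! i"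
    using assms(2,4) len nth[of z y] unfolding order_isomorphic_def
    by (metis One_nat_def Suc_less_eq add_2_eq_Suc' length_Cons nth_Cons_0 nth_Cons_Suc zero_less_Suc)
  ultimately show ?thesis by simp
qed

lemma consecutive_if_none_between:
  assumes "2 \<le> k" "\<sigma> \<in> permutations_of_set {1..k}"
    and none: "\<And>i. 2 \<le> i \<Longrightarrow> i < k \<Longrightarrow> \<sigma> ! 0 < \<sigma> ! i \<longleftrightarrow> \<sigma> ! 1 < \<sigma> ! i"
  shows "\<sigma> ! 0 = \<sigma> ! 1 + 1 \<or> \<sigma> ! 1 = \<sigma> ! 0 + 1"
proof (rule ccontr)
  assume nc: "\<not> ?thesis"
  have \<sigma>: "distinct \<sigma>" "set \<sigma> = {1..k}" "length \<sigma> = k"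
    using assms(2) length_finite_permutations_of_set[OF assms(2)] by (auto dest: permutations_of_setD)
  have in01: "\<sigma> ! 0 \<in> {1..k}" "\<sigma> ! 1 \<in> {1..k}" 
    using \<sigma> assms(1) nth_mem[of 0 \<sigma>] nth_mem[of 1 \<sigma>] by auto
  have ne: "\<sigma> ! 0 \<noteq> \<sigma> ! 1" using \<sigma> assms(1) by (simp add: nth_eq_iff_index_eq)
  \<comment> \<open>For nonconsecutive entries this value lies strictly between them, and so is some
    later entry of \<sigma>.\<close>
  define v where "v = min (\<sigma> ! 0) (\<sigma> ! 1) + 1"
  have v: "v \<in> {1..k}" "v \<noteq> \<sigma> ! 0" "v \<noteq> \<sigma> ! 1" "\<sigma> ! 0 < v \<longleftrightarrow> \<not> \<sigma> ! 1 < v"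
    using nc ne in01 by (auto simp: v_def min_def)
  then obtain i where i: "i < k" "\<sigma> ! i = v" using \<sigma> by (metis in_set_conv_nth)
  then have "2 \<le> i" using v by (cases i rule: nat.exhaust; cases "i - 1") auto
  with none i v show False by blast
qed

lemma consecutive_if_catalan:
  assumes "2 \<le> k" "\<sigma> \<in> permutations_of_set {1..k}" "k < n" "\<pi> \<in> permutations_of_set {1..n}"
    and card: "card (preimages \<sigma> n \<pi>) = catalan (n - k + 2)"
  shows "\<sigma> ! 0 = \<sigma> ! 1 + 1 \<or> \<sigma> ! 1 = \<sigma> ! 0 + 1"
proof -
  have len: "length \<sigma> = k" "length \<pi> = n"
    using assms length_finite_permutations_of_set by fastforce+
  define p r where "p = take (n - k + 2) \<pi>" and "r = drop (n - k + 2) \<pi>"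
  have \<pi>: "\<pi> = p @ r" "length p = n - k + 2" and r: "length r + 2 = length \<sigma>"
    using len assms by (auto simp: p_def r_def)
  have "stack_run {\<sigma>} r p = p @ r"
    using identity_preimage_if_catalan[OF r, of n p] card \<pi> len assms(3) by simp
  \<comment> \<open>\<open>k < n\<close> gives \<open>p\<close> at least three entries, hence two
    overlapping pairs.\<close>
  moreover obtain x y z q where p: "p = x # y # z # q"
    using \<pi>(2) assms(3) by (cases p rule: remdups_adj.cases; cases "tl (tl p)") auto
  moreover have "distinct (x # y # z # q @ r)"
    using permutations_of_setD(2)[OF assms(4)] \<pi> p by simp
  ultimately have "order_isomorphic (y # x # r) \<sigma>" "order_isomorphic (z # y # r) \<sigma>"
    using stack_run_pops_first[OF r, of x y "z # q" "y # z # q @ r"]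
      stack_run_pops_first[OF r, of y z q "z # q @ r"] by auto
  then show ?thesis
    using consecutive_if_none_between[OF assms(1,2)] no_entry_between len by blast
qed

section \<open>Consecutive leading entries\<close>

lemma order_isomorphic_map:
  assumes "strict_mono_on (set xs) f"
  shows "order_isomorphic (map f xs) xs"
  using assms by (auto simp: order_isomorphic_def strict_mono_on_less)

text \<open>As \<open>r\<close> is two entries short, an occurrence takes its first two entries from
  \<open>a\<close>, whose order \<open>R\<close> is opposite to that of \<open>\<sigma> ! 0\<close>
  and \<open>\<sigma> ! 1\<close>.\<close>

lemma avoids_if_top_monotone:
  assumes R: "R = (<) \<and> \<sigma> ! 1 < \<sigma> ! 0 \<or> R = (>) \<and> \<sigma> ! 0 < \<sigma> ! 1"
    and p: "sorted_wrt R p" "subseq a p" and r: "length r + 2 = length \<sigma>"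
  shows "\<not> contains_pattern (a @ r) \<sigma>"
proof
  assume "contains_pattern (a @ r) \<sigma>"
  then obtain ys where ys: "subseq ys (a @ r)" "order_isomorphic ys \<sigma>"
    by (auto simp: contains_pattern_def)
  then obtain ys1 ys2 where eq: "ys = ys1 @ ys2" "subseq ys1 a" "subseq ys2 r"
    by (auto elim: subseq_appendE)
  have len: "length ys = length \<sigma>" using ys(2) by (simp add: order_isomorphic_def)
  then have l2: "2 \<le> length ys1" using list_emb_length[OF eq(3)] r eq(1) by simp
  have "sorted_wrt R ys1"
    using p eq(2) by (meson sorted_wrt_subseq subseq_order.order_trans)
  then have "R (ys ! 0) (ys ! 1)"
    using l2 eq(1) by (cases ys1 rule: remdups_adj.cases) auto
  moreover have "\<forall>i<2. \<forall>j<2. ys ! i < ys ! j \<longleftrightarrow> \<sigma> ! i < \<sigma> ! j"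
    using ys(2) r len by (simp add: order_isomorphic_def)
  ultimately show False using R by (auto dest: spec[of _ 0] spec[of _ 1])
qed

lemma catalan_preimages_if_consecutive:
  assumes "2 \<le> k" "\<sigma> \<in> permutations_of_set {1..k}" "k \<le> n"
    and cons: "\<sigma> ! 0 = \<sigma> ! 1 + 1 \<or> \<sigma> ! 1 = \<sigma> ! 0 + 1"
  shows "\<exists>\<pi> \<in> permutations_of_set {1..n}. card (preimages \<sigma> n \<pi>) = catalan (n - k + 2)"
proof -
  obtain s0 s1 t where \<sigma>: "\<sigma> = s0 # s1 # t" 
    using length_finite_permutations_of_set[OF assms(2)] assms(1)
    by (cases \<sigma> rule: remdups_adj.cases) auto
  have dist: "distinct (s0 # s1 # t)" and set: "set (s0 # s1 # t) = {1..k}" and len: "length t + 2 = k"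
    using permutations_of_setD[OF assms(2)] length_finite_permutations_of_set[OF assms(2)]
    unfolding \<sigma> by simp_all
  have cons': "s0 = s1 + 1 \<or> s1 = s0 + 1" using cons \<sigma> by simp
  \<comment> \<open>\<open>t\<close> misses exactly the values \<open>c\<close> and
    \<open>c + 1\<close>; \<open>shift\<close> widens this gap to \<open>d + 2\<close> values, which
    \<open>p\<close> fills.\<close>
  define d c where "d = n - k" and "c = min s0 s1"
  define shift where "shift v = (if v \<le> c then v else v + d)" for v
  define r where "r = map shift t"
  \<comment> \<open>\<open>p\<close> ascends when \<sigma> starts with a descent: a later entry of
    \<open>p\<close>, put on top of an earlier one, has to play \<open>\<sigma> ! 0\<close>.\<close>
  define p where "p = (if s1 < s0 then [c..<c + d + 2] else rev [c..<c + d + 2])"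
  define R where "R = (if s1 < s0 then (<) else (>) :: nat \<Rightarrow> nat \<Rightarrow> bool)"
  have set_t: "set t = {1..k} - {c, c + 1}" and c: "1 \<le> c" "c + 1 \<le> k"
    using dist set cons' by (auto simp: c_def min_def)
  have len_p: "length p = n - k + 2" by (simp add: p_def d_def)
  have len_r: "length r + 2 = length \<sigma>" by (simp add: r_def \<sigma>)
  have set_p: "set p = {c..<c + d + 2}" by (simp add: p_def del: upt_Suc)
  have sorted: "sorted_wrt R p"
    by (simp add: p_def R_def sorted_wrt_rev del: upt_Suc)
  have set_r: "set r = {1..<c} \<union> {c + d + 2..n}"
  proof -
    have "shift ` ({1..k} - {c, c + 1}) = {1..<c} \<union> {c + d + 2..n}" (is "?L = ?R")
    proof
      show "?L \<subseteq> ?R" using assms(3) by (auto simp: shift_def d_def)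
      show "?R \<subseteq> ?L"
      proof
        fix v assume v: "v \<in> ?R"
        show "v \<in> ?L"
        proof (cases "v < c")
          case True
          then show ?thesis using v c by (intro image_eqI[of _ _ v]) (auto simp: shift_def)
        next
          case False
          then show ?thesis using v c assms(3)
            by (intro image_eqI[of _ _ "v - d"]) (auto simp: shift_def d_def)
        qed
      qed
    qed
    then show ?thesis by (simp add: r_def set_t)
  qed
  have "distinct r"
    using dist by (auto simp: r_def distinct_map shift_def inj_on_def split: if_splits)
  then have \<pi>: "p @ r \<in> permutations_of_set {1..n}"
    using c assms(3) by (intro permutations_of_setI) (auto simp: set_p set_r, auto simp: p_def d_def)
  have pattern: "contains_pattern (x # s # r) \<sigma>" if "R s x" "s \<in> set p" "x \<in> set p" for s x
  proof -
    \<comment> \<open>\<open>f\<close> is \<open>shift\<close> with the images of \<open>s0\<close>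
      and \<open>s1\<close> moved to \<open>x\<close> and \<open>s\<close>, which lie in the widened
      gap in the required order.\<close>
    define f where "f v = (if v = s0 then x else if v = s1 then s else shift v)" for v
    have "map f \<sigma> = x # s # r"
      using dist by (auto simp: \<sigma> f_def r_def)
    moreover have "strict_mono_on (set \<sigma>) f"
      using that cons' unfolding set_p R_def c_def
      by (intro strict_mono_onI) (auto simp: f_def shift_def c_def min_def split: if_splits)
    ultimately show ?thesis
      using order_isomorphic_map[of \<sigma> f] unfolding contains_pattern_def by auto
  qed
  have "sorted_wrt (\<lambda>s x. contains_pattern (x # s # r) \<sigma>) p"
    by (rule sorted_wrt_mono_rel[OF _ sorted]) (rule pattern)
  moreover have "\<not> contains_pattern (a @ r) \<sigma>" if "subseq a p" for a
    using avoids_if_top_monotone[OF _ sorted that len_r] cons' by (auto simp: R_def \<sigma>)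
  ultimately have "card (preimages \<sigma> n (p @ r)) = catalan (n - k + 2)"
    using card_preimages_eq_catalan[OF len_r _ \<pi>] len_p len \<sigma> assms(3) by auto
  with \<pi> show ?thesis by blast
qed

theorem theorem3p2:
  fixes \<sigma> :: "nat list" and k :: nat
  assumes "k \<ge> 2" and "\<sigma> \<in> permutations_of_set {1..k}"
  shows "((\<sigma> ! 0 = \<sigma> ! 1 + 1 \<or> \<sigma> ! 1 = \<sigma> ! 0 + 1) \<longrightarrow>
           (\<forall>n\<ge>k. \<exists>\<pi> \<in> permutations_of_set {1..n}.
              card {\<rho> \<in> permutations_of_set {1..n}. stack_map {\<sigma>} \<rho> = \<pi>} = catalan (n - k + 2))) \<and>
         (\<not> (\<sigma> ! 0 = \<sigma> ! 1 + 1 \<or> \<sigma> ! 1 = \<sigma> ! 0 + 1) \<longrightarrow>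
           (\<forall>n>k. \<not> (\<exists>\<pi> \<in> permutations_of_set {1..n}.
              card {\<rho> \<in> permutations_of_set {1..n}. stack_map {\<sigma>} \<rho> = \<pi>} = catalan (n - k + 2))))"
  unfolding preimages_def[symmetric]
proof (intro conjI impI allI)
  show "\<exists>\<pi>\<in>permutations_of_set {1..n}. card (preimages \<sigma> n \<pi>) = catalan (n - k + 2)"
    if "\<sigma> ! 0 = \<sigma> ! 1 + 1 \<or> \<sigma> ! 1 = \<sigma> ! 0 + 1" "k \<le> n" for n
    using catalan_preimages_if_consecutive[OF assms that(2,1)] .
  show "\<not> (\<exists>\<pi>\<in>permutations_of_set {1..n}. card (preimages \<sigma> n \<pi>) = catalan (n - k + 2))"
    if "\<not> (\<sigma> ! 0 = \<sigma> ! 1 + 1 \<or> \<sigma> ! 1 = \<sigma> ! 0 + 1)" "k < n" for n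
  proof
    assume "\<exists>\<pi>\<in>permutations_of_set {1..n}. card (preimages \<sigma> n \<pi>) = catalan (n - k + 2)"
    then obtain \<pi> where "\<pi> \<in> permutations_of_set {1..n}"
        "card (preimages \<sigma> n \<pi>) = catalan (n - k + 2)"
      by (rule bexE)
    from consecutive_if_catalan[OF assms that(2) this] that(1) show False by (rule notE[rotated])
  qed
qed

end
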